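(* Let $I$ be an instance of the minimum weight maximum cardinality matching problem on the complete undirected graph $G$ with $n$ vertices $1,\ldots,n$ and real edge weights $w(i,j)=w(j,i)$, $i\ne j$. (i) If $n$ is odd, then $I$ has the constant objective value property (COVP) if and only if all edge weights are equal. (ii) If $n$ is even, then $I$ has the COVP if and only if there exists a real vector $A=(a_1,\ldots,a_n)$ such that $w(i,j)=a_i+a_j$ for all $i\neq j$.
   Context: The feasible solutions of the minimum weight maximum cardinality matching problem are the matchings of $G$ having maximum cardinality among all matchings of $G$; the objective value of a matching is the sum of the weights of its edges. An instance has the constant objective value property (COVP) if all feasible solutions have the same objective value. *)

theory Defs
  imports Complex_Main
begin

(* Undirected edges are two-element vertex sets.  A graph enters only through its edge set,
   since matchings do not depend on isolated vertices. *)
definition complete_graph_edges :: "nat \<Rightarrow> nat set set" where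
  "complete_graph_edges n = {{i, j} | i j. i \<in> {1..n} \<and> j \<in> {1..n} \<and> i \<noteq> j}"

definition matching :: "'a set set \<Rightarrow> 'a set set \<Rightarrow> bool" where
  "matching E M \<longleftrightarrow> M \<subseteq> E \<and> pairwise disjnt M"

(* Intended for finite E; card is 0 on infinite sets. *)
definition maximum_matchings :: "'a set set \<Rightarrow> 'a set set set" where
  "maximum_matchings E = {M. matching E M \<and> (\<forall>M'. matching E M' \<longrightarrow> card M' \<le> card M)}"

(* For a weight symmetric on the two ends of e, the choice of orientation is irrelevant;
   see edge_weight_pair. *)
definition edge_weight :: "(nat \<Rightarrow> nat \<Rightarrow> real) \<Rightarrow> nat set \<Rightarrow> real" where
  "edge_weight w e = w (Min e) (Max e)"

definition matching_weight :: "(nat \<Rightarrow> nat \<Rightarrow> real) \<Rightarrow> nat set set \<Rightarrow> real" where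
  "matching_weight w M = (\<Sum>e\<in>M. edge_weight w e)"

definition constant_objective_value :: "'s set \<Rightarrow> ('s \<Rightarrow> real) \<Rightarrow> bool" where
  "constant_objective_value F obj \<longleftrightarrow> (\<forall>S\<in>F. \<forall>T\<in>F. obj S = obj T)"

definition matching_COVP :: "nat \<Rightarrow> (nat \<Rightarrow> nat \<Rightarrow> real) \<Rightarrow> bool" where
  "matching_COVP n w \<longleftrightarrow>
     constant_objective_value (maximum_matchings (complete_graph_edges n)) (matching_weight w)"

lemma edge_weight_pair:
  assumes "w i j = w j i"
  shows "edge_weight w {i, j} = w i j"
  using assms by (simp add: edge_weight_def min_def max_def)

lemma finite_complete_graph_edges: "finite (complete_graph_edges n)"
proof (rule finite_subset)
  show "complete_graph_edges n \<subseteq> Pow {1..n}"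
    by (auto simp: complete_graph_edges_def)
qed simp

end

theory Submission
  imports Defs
begin

(* Both necessity claims come from local exchanges: two matchings with the same number of edges
   that cover as much as possible of a small vertex set U, where the remaining vertices are even
   in number, extend by one and the same perfect matching of the remaining vertices to maximum
   matchings, so under the COVP they have equal weight.  For odd n take U = {i, j, k}: any two
   edges sharing a vertex have equal weight.  For even n take U = {i, j, k, l}:
   w(i,j) + w(k,l) = w(i,k) + w(j,l), and this four-point condition forces w(i,j) = a(i) + a(j),
   where a(1) is determined by the triangle 1, 2, 3 and a(i) = w(1,i) - a(1) otherwise. *)

section \<open>Matchings of the complete graph and their maximum size\<close>

lemma complete_graph_edges_eq: "complete_graph_edges n = {e. e \<subseteq> {1..n} \<and> card e = 2}"
proof -
  have "e \<in> complete_graph_edges n \<longleftrightarrow> e \<subseteq> {1..n} \<and> card e = 2" for e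
    unfolding complete_graph_edges_def card_2_iff by blast
  then show ?thesis by blast
qed

lemma card_Union_pairs:
  assumes "pairwise disjnt M" "\<And>e. e \<in> M \<Longrightarrow> card e = 2"
  shows "card (\<Union>M) = 2 * card M"
proof -
  have "card (\<Union>M) = sum card M"
    using assms by (intro card_Union_disjoint) (auto intro: card_ge_0_finite)
  also have "\<dots> = 2 * card M"
    using assms(2) by simp
  finally show ?thesis .
qed

text \<open>Used twice: to attain the bound on the size of a matching, and to fill up the complement
  of an exchange set. The induction splits off an arbitrary pair \<open>e\<close>, which keeps the
  parity.\<close>

lemma ex_perfect_matching:
  assumes "finite S" "even (card S)"
  shows "\<exists>M. pairwise disjnt M \<and> (\<forall>e\<in>M. card e = 2) \<and> \<Union>M = S"
  using assms
proof (induction "card S" arbitrary: S rule: less_induct)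
  case less
  show ?case
  proof (cases "S = {}")
    case True
    then show ?thesis by (intro exI[of _ "{}"]) auto
  next
    case False
    with less.prems have "card S \<noteq> 0" by simp
    with less.prems(2) have "2 \<le> card S" by presburger
    then obtain e where e: "e \<subseteq> S" "card e = 2"
      by (meson obtain_subset_with_card_n)
    have "finite e" using e less.prems(1) finite_subset by blast
    then have "card (S - e) = card S - 2"
      using e by (simp add: card_Diff_subset)
    then have "card (S - e) < card S" "even (card (S - e))"
      using \<open>2 \<le> card S\<close> less.prems(2) by auto
    with less obtain M where M: "pairwise disjnt M" "\<forall>e\<in>M. card e = 2" "\<Union>M = S - e"
      by (metis finite_Diff)
    have "pairwise disjnt (insert e M)"
      using M by (auto simp: pairwise_insert disjnt_def)
    then show ?thesis
      using M e by (intro exI[of _ "insert e M"]) auto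
  qed
qed

lemma matching_complete_graph_iff:
  "matching (complete_graph_edges n) M \<longleftrightarrow>
     \<Union>M \<subseteq> {1..n} \<and> (\<forall>e\<in>M. card e = 2) \<and> pairwise disjnt M"
  unfolding matching_def complete_graph_edges_eq by blast

lemma card_matching_complete_graph_le:
  assumes "matching (complete_graph_edges n) M"
  shows "card M \<le> n div 2"
proof -
  have "2 * card M = card (\<Union>M)"
    using assms card_Union_pairs[of M] by (simp add: matching_complete_graph_iff)
  also have "\<dots> \<le> card {1..n}"
    using assms by (intro card_mono) (auto simp: matching_complete_graph_iff)
  finally show ?thesis by simp
qed

text \<open>A matching covers twice as many vertices as it has edges, hence the upper bound; a
  perfect matching of an even vertex set attains it.\<close>

lemma maximum_matchings_complete_graph:
  "maximum_matchings (complete_graph_edges n) =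
     {M. matching (complete_graph_edges n) M \<and> card M = n div 2}"
proof -
  \<comment> \<open>The largest even size available: \<open>S\<close> omits one vertex exactly when
    \<open>n\<close> is odd.\<close>
  obtain S where S: "S \<subseteq> {1..n}" "card S = 2 * (n div 2)"
    by (metis card_atLeastAtMost diff_Suc_1 obtain_subset_with_card_n times_div_less_eq_dividend)
  have "finite S" using S(1) finite_subset by blast
  with S obtain M where M: "pairwise disjnt M" "\<forall>e\<in>M. card e = 2" "\<Union>M = S"
    using ex_perfect_matching[of S] by auto
  then have "card M = n div 2"
    using S card_Union_pairs[of M] by simp
  moreover have "matching (complete_graph_edges n) M"
    using M S by (simp add: matching_complete_graph_iff)
  ultimately show ?thesis
    using card_matching_complete_graph_le[of n]
    unfolding maximum_matchings_def by (auto, metis le_antisym)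
qed

section \<open>Exchange arguments under the COVP\<close>

text \<open>Rounding down in \<open>card U div 2\<close> serves both parities: since
  \<open>n - card U\<close> is even, \<open>card U div 2\<close> edges inside \<open>U\<close> and a
  perfect matching of the rest add up to \<open>n div 2\<close>, also when one vertex of
  \<open>U\<close> stays uncovered.\<close>

lemma COVP_exchange:
  assumes COVP: "matching_COVP n w"
    and X: "matching (complete_graph_edges n) X" and Y: "matching (complete_graph_edges n) Y"
    and U: "U = \<Union>X \<union> \<Union>Y" and parity: "even (card U) \<longleftrightarrow> even n"
    and card_X: "card X = card U div 2" and card_Y: "card Y = card U div 2"
  shows "matching_weight w X = matching_weight w Y"
proof -
  have sub: "U \<subseteq> {1..n}"
    using X Y U by (simp add: matching_complete_graph_iff)
  then have fin: "finite U"
    using finite_subset by blast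
  have le: "card U \<le> n"
    using sub card_mono[of "{1..n}" U] by simp
  have cd: "card ({1..n} - U) = n - card U"
    using sub fin by (simp add: card_Diff_subset)
  then obtain P where P: "pairwise disjnt P" "\<forall>e\<in>P. card e = 2" "\<Union>P = {1..n} - U"
    using ex_perfect_matching[of "{1..n} - U"] parity le by auto
  then have n_eq: "n = card U + 2 * card P"
    using card_Union_pairs[of P] cd le by simp
  have finP: "finite P"
    using P(3) by (metis finite_Diff finite_UnionD finite_atLeastAtMost)
  \<comment> \<open>Applied to \<open>X\<close> and to \<open>Y\<close> with the same
    \<open>P\<close>, so that the weight of \<open>P\<close> cancels in the end.\<close>
  have extend: "Z \<union> P \<in> maximum_matchings (complete_graph_edges n)
      \<and> matching_weight w (Z \<union> P) = matching_weight w Z + matching_weight w P"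
    if Z: "matching (complete_graph_edges n) Z" "\<Union>Z \<subseteq> U" "card Z = card U div 2" for Z
  proof -
    have finZ: "finite Z"
      using Z(2) fin by (metis finite_UnionD finite_subset)
    have dj: "disjnt e f" if "e \<in> Z" "f \<in> P" for e f
      using that Z(2) P(3) by (auto simp: disjnt_def)
    have ZP: "Z \<inter> P = {}"
    proof (rule ccontr)
      assume "Z \<inter> P \<noteq> {}"
      then obtain e where "e \<in> Z" "e \<in> P" by blast
      \<comment> \<open>A common edge would be disjoint from itself.\<close>
      then have "e = {}" "card e = 2"
        using dj[of e e] P(2) by (auto simp: disjnt_def)
      then show False by simp
    qed
    have "pairwise disjnt (Z \<union> P)"
      using Z(1) P(1) dj unfolding matching_complete_graph_iff pairwise_def
      by (metis Un_iff disjnt_sym)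
    then have "matching (complete_graph_edges n) (Z \<union> P)"
      using Z(1) P by (auto simp: matching_complete_graph_iff)
    moreover have "card (Z \<union> P) = n div 2"
      using card_Un_disjoint[OF finZ finP ZP] Z(3) n_eq by simp
    ultimately show ?thesis
      by (simp add: maximum_matchings_complete_graph matching_weight_def
          sum.union_disjoint[OF finZ finP ZP])
  qed
  show ?thesis
    using COVP extend[OF X _ card_X] extend[OF Y _ card_Y] U
    unfolding matching_COVP_def constant_objective_value_def
    by (metis Un_upper1 Un_upper2 add_right_cancel)
qed

lemma matching_singleton:
  assumes "i \<in> {1..n}" "j \<in> {1..n}" "i \<noteq> j"
  shows "matching (complete_graph_edges n) {{i, j}}"
  using assms by (simp add: matching_complete_graph_iff)

lemma matching_two_edges:
  assumes "{i, j, k, l} \<subseteq> {1..n}" "distinct [i, j, k, l]"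
  shows "matching (complete_graph_edges n) {{i, j}, {k, l}}"
  using assms by (auto simp: matching_complete_graph_iff pairwise_insert disjnt_def)

locale symmetric_weight =
  fixes n :: nat and w :: "nat \<Rightarrow> nat \<Rightarrow> real"
  assumes sym: "\<And>i j. i \<in> {1..n} \<Longrightarrow> j \<in> {1..n} \<Longrightarrow> i \<noteq> j \<Longrightarrow> w i j = w j i"
begin

lemma matching_weight_singleton:
  assumes "i \<in> {1..n}" "j \<in> {1..n}" "i \<noteq> j"
  shows "matching_weight w {{i, j}} = w i j"
  using assms sym by (simp add: matching_weight_def edge_weight_pair)

lemma matching_weight_two_edges:
  assumes "{i, j, k, l} \<subseteq> {1..n}" "distinct [i, j, k, l]"
  shows "matching_weight w {{i, j}, {k, l}} = w i j + w k l"
proof -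
  have "{i, j} \<noteq> {k, l}" using assms by (auto simp: doubleton_eq_iff)
  moreover have "edge_weight w {i, j} = w i j" "edge_weight w {k, l} = w k l"
    using assms sym by (simp_all add: edge_weight_pair)
  ultimately show ?thesis
    by (simp add: matching_weight_def)
qed

lemma COVP_odd_exchange:
  assumes "matching_COVP n w" "odd n"
    and ijk: "i \<in> {1..n}" "j \<in> {1..n}" "k \<in> {1..n}" "distinct [i, j, k]"
  shows "w i j = w i k"
proof -
  have "matching_weight w {{i, j}} = matching_weight w {{i, k}}"
  proof (rule COVP_exchange[where U = "{i, j, k}"])
    show "matching (complete_graph_edges n) {{i, j}}" "matching (complete_graph_edges n) {{i, k}}"
      using ijk matching_singleton by simp_all
  qed (use assms in auto)
  then show ?thesis
    using ijk by (simp add: matching_weight_singleton)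
qed

lemma COVP_even_exchange:
  assumes "matching_COVP n w" "even n"
    and ijkl: "{i, j, k, l} \<subseteq> {1..n}" "distinct [i, j, k, l]"
  shows "w i j + w k l = w i k + w j l"
proof -
  have "matching_weight w {{i, j}, {k, l}} = matching_weight w {{i, k}, {j, l}}"
  proof (rule COVP_exchange[where U = "{i, j, k, l}"])
    show "matching (complete_graph_edges n) {{i, j}, {k, l}}"
      "matching (complete_graph_edges n) {{i, k}, {j, l}}"
      using ijkl by (auto intro!: matching_two_edges)
  qed (use assms in \<open>auto simp: doubleton_eq_iff\<close>)
  moreover have "matching_weight w {{i, k}, {j, l}} = w i k + w j l"
    using ijkl by (intro matching_weight_two_edges) auto
  ultimately show ?thesis
    using ijkl by (simp add: matching_weight_two_edges)
qed

section \<open>Necessity: the shape of the weights forced by the COVP\<close>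

lemma COVP_odd_constant:
  assumes "matching_COVP n w" "odd n"
  shows "\<exists>c. \<forall>i\<in>{1..n}. \<forall>j\<in>{1..n}. i \<noteq> j \<longrightarrow> w i j = c"
\<comment> \<open>If \<open>n = 1\<close>, then 2 is not a vertex, but there is no pair
  \<open>i\<close>, \<open>j\<close> to consider either.\<close>
proof (intro exI[of _ "w 1 2"] ballI impI)
  fix i j assume ij: "i \<in> {1..n}" "j \<in> {1..n}" "i \<noteq> j"
  have star: "w 1 k = w 1 2" if "k \<in> {1..n}" "k \<noteq> 1" for k
  proof (cases "k = 2")
    case False
    then show ?thesis
      using that by (intro COVP_odd_exchange[OF assms]) auto
  qed simp
  show "w i j = w 1 2"
  proof (cases "i = 1")
    case True
    then show ?thesis using ij star[of j] by simp
  next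
    case False
    \<comment> \<open>The exchange at \<open>i\<close> moves the edge to the star of vertex 1, where
      \<open>star\<close> applies.\<close>
    have "w i j = w i 1"
    proof (cases "j = 1")
      case j: False
      show ?thesis
        using ij False j by (intro COVP_odd_exchange[OF assms]) auto
    qed simp
    also have "\<dots> = w 1 i"
      using ij False by (intro sym) auto
    finally show ?thesis
      using star[of i] ij False by simp
  qed
qed

lemma COVP_even_sum:
  assumes "matching_COVP n w" "even n"
  shows "\<exists>a. \<forall>i\<in>{1..n}. \<forall>j\<in>{1..n}. i \<noteq> j \<longrightarrow> w i j = a i + a j"
\<comment> \<open>The exchange needs four distinct vertices. For \<open>n = 2\<close> the only
  weight is split evenly; for \<open>n = 0\<close> nothing is claimed.\<close>
proof (cases "n < 4")
  case True
  with \<open>even n\<close> have "n = 0 \<or> n = 2" by presburger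
  then have "w i j = w 1 2 / 2 + w 1 2 / 2" if "i \<in> {1..n}" "j \<in> {1..n}" "i \<noteq> j" for i j
  proof -
    have "i = 1 \<and> j = 2 \<or> i = 2 \<and> j = 1"
      using that \<open>n = 0 \<or> n = 2\<close> by auto
    then show ?thesis using that sym by auto
  qed
  then show ?thesis
    by (intro exI[of _ "\<lambda>_. w 1 2 / 2"]) blast
next
  case False
  \<comment> \<open>The value of \<open>a 1\<close> obtained by solving
    \<open>a 1 + a 2 = w 1 2\<close>, \<open>a 1 + a 3 = w 1 3\<close>,
    \<open>a 2 + a 3 = w 2 3\<close>.\<close>
  define b where "b = (w 1 2 + w 1 3 - w 2 3) / 2"
  then have b: "2 * b = w 1 2 + w 1 3 - w 2 3" by simp
  \<comment> \<open>With the definition of \<open>b\<close>, the right-hand side is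
    \<open>w 1 2 + w 1 j - 2 * b\<close>, so this is the instance \<open>i = 2\<close> of
    \<open>gen\<close>.\<close>
  have two: "w 2 j = w 1 j - w 1 3 + w 2 3" if "j \<in> {1..n}" "j \<noteq> 1" "j \<noteq> 2" for j
  proof (cases "j = 3")
    case False
    with that \<open>\<not> n < 4\<close> show ?thesis
      using COVP_even_exchange[OF assms, of 1 3 j 2] sym[of 2 j] sym[of 2 3] by auto
  qed simp
  have gen: "w i j = w 1 i + w 1 j - 2 * b"
    if "i \<in> {1..n}" "j \<in> {1..n}" "i \<noteq> j" "i \<noteq> 1" "j \<noteq> 1" for i j
  proof (cases "i = 2 \<or> j = 2")
    case True
    then show ?thesis
      using that two[of i] two[of j] sym[of i j] b by auto
  next
    case F: False
    \<comment> \<open>The exchange on 1, 2, \<open>i\<close>, \<open>j\<close> reduces a pair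
      avoiding 1 and 2 to the edges at these two vertices.\<close>
    have "w 1 2 + w i j = w 1 i + w 2 j"
      using that F False by (intro COVP_even_exchange[OF assms]) auto
    then show ?thesis
      using that F two[of j] b by simp
  qed
  show ?thesis
  proof (intro exI[of _ "\<lambda>i. if i = 1 then b else w 1 i - b"] ballI impI)
    fix i j assume "i \<in> {1..n}" "j \<in> {1..n}" "i \<noteq> j"
    then show "w i j = (if i = 1 then b else w 1 i - b) + (if j = 1 then b else w 1 j - b)"
      using gen[of i j] sym[of i j] by auto
  qed
qed

section \<open>Sufficiency: weights of these shapes give the COVP\<close>

lemma constant_imp_COVP:
  assumes c: "\<forall>i\<in>{1..n}. \<forall>j\<in>{1..n}. i \<noteq> j \<longrightarrow> w i j = c"
  shows "matching_COVP n w"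
proof -
  have "edge_weight w e = c" if e: "e \<in> complete_graph_edges n" for e
  proof -
    obtain i j where "e = {i, j}" "i \<in> {1..n}" "j \<in> {1..n}" "i \<noteq> j"
      using e unfolding complete_graph_edges_def by blast
    then show ?thesis
      using c sym by (simp add: edge_weight_pair)
  qed
  then have "matching_weight w M = of_nat (n div 2) * c"
    if "M \<in> maximum_matchings (complete_graph_edges n)" for M
    using that unfolding maximum_matchings_complete_graph matching_def matching_weight_def
    by (simp add: subset_iff)
  then show ?thesis
    by (simp add: matching_COVP_def constant_objective_value_def)
qed

text \<open>For even \<open>n\<close> a maximum matching is perfect, so summing \<open>a\<close>
  over the ends of its edges counts every vertex exactly once.\<close>

lemma sum_imp_COVP:
  assumes "even n" and a: "\<forall>i\<in>{1..n}. \<forall>j\<in>{1..n}. i \<noteq> j \<longrightarrow> w i j = a i + a j"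
  shows "matching_COVP n w"
proof -
  have edge: "edge_weight w e = sum a e" if e: "e \<in> complete_graph_edges n" for e
  proof -
    obtain i j where "e = {i, j}" "i \<in> {1..n}" "j \<in> {1..n}" "i \<noteq> j"
      using e unfolding complete_graph_edges_def by blast
    then show ?thesis
      using a sym by (simp add: edge_weight_pair)
  qed
  have "matching_weight w M = sum a {1..n}"
    if M: "M \<in> maximum_matchings (complete_graph_edges n)" for M
  proof -
    have matching: "matching (complete_graph_edges n) M" and cM: "card M = n div 2"
      using M by (simp_all add: maximum_matchings_complete_graph)
    then have mat: "\<Union>M \<subseteq> {1..n}" "\<forall>e\<in>M. card e = 2" "pairwise disjnt M"
      by (simp_all add: matching_complete_graph_iff)
    have sub: "M \<subseteq> complete_graph_edges n"
      using matching by (simp add: matching_def)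
    have "card (\<Union>M) = card {1..n}"
      using card_Union_pairs[of M] mat cM \<open>even n\<close> by simp
    with mat(1) have cover: "\<Union>M = {1..n}"
      by (intro card_subset_eq) auto
    have "matching_weight w M = (\<Sum>e\<in>M. sum a e)"
      using edge sub by (auto simp: matching_weight_def intro!: sum.cong)
    also have "\<dots> = sum a (\<Union>M)"
      using mat by (subst sum.Union_disjoint)
        (auto simp: pairwise_def disjnt_def intro: card_ge_0_finite)
    finally show ?thesis
      using cover by simp
  qed
  then show ?thesis
    by (simp add: matching_COVP_def constant_objective_value_def)
qed

end

theorem theorem4p5:
  fixes n :: nat and w :: "nat \<Rightarrow> nat \<Rightarrow> real"
  assumes sym: "\<And>i j. i \<in> {1..n} \<Longrightarrow> j \<in> {1..n} \<Longrightarrow> i \<noteq> j \<Longrightarrow> w i j = w j i"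
  shows "(odd n \<longrightarrow>
            (matching_COVP n w \<longleftrightarrow>
              (\<exists>c::real. \<forall>i\<in>{1..n}. \<forall>j\<in>{1..n}. i \<noteq> j \<longrightarrow> w i j = c))) \<and>
         (even n \<longrightarrow>
            (matching_COVP n w \<longleftrightarrow>
              (\<exists>a :: nat \<Rightarrow> real. \<forall>i\<in>{1..n}. \<forall>j\<in>{1..n}. i \<noteq> j \<longrightarrow> w i j = a i + a j)))"
proof -
  interpret symmetric_weight n w
    by unfold_locales (rule sym)
  show ?thesis
    using COVP_odd_constant COVP_even_sum constant_imp_COVP sum_imp_COVP by blast
qed

end
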